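(* Let $h:J\subseteq\mathbb{R}\to\mathbb{R}$ be a nonnegative super-multiplicative function with $h(\alpha)\ge\alpha$ for all $\alpha\in(0,1)$. Let $f:I\subseteq\mathbb{R}\to\mathbb{R}$ be a differentiable mapping on $I^{\circ}$ such that $f'\in L[a,b]$, where $a,b\in I$ with $a<b$. Let $q\ge1$. If $|f'|^q$ is an $h$-convex function on $[a,b]$ and $|f'(x)|\le M$ for all $x\in[a,b]$, then for each $x\in[a,b]$ $$\left|f(x)-\frac{1}{b-a}\int_a^b f(u)\,du\right|\le \frac{\sqrt[q]{2}\,M}{2(b-a)}\left((x-a)^2+(b-x)^2\right)\left(\int_0^1\left(h(t^2)+h(t-t^2)\right)dt\right)^{\frac1q}.$$
   Context: $I\subseteq\mathbb{R}$ is an interval, $I^{\circ}$ is its interior, and $L[a,b]$ is the space of Lebesgue integrable functions on $[a,b]$. $J\subseteq\mathbb{R}$ is an interval with $[0,1]\subseteq J$, and $h\not\equiv 0$. $h:J\to\mathbb{R}$ is super-multiplicative if $h(xy)\ge h(x)h(y)$ for all $x,y\in J$ with $xy\in J$. A function $g$ on an interval $K$ is $h$-convex on $K$ (for a nonnegative $h:J\to\mathbb{R}$, $h\not\equiv0$) if $g$ is nonnegative and $g(tx+(1-t)y)\le h(t)g(x)+h(1-t)g(y)$ for all $x,y\in K$ and $t\in[0,1]$. Hypotheses on the values of $f'$ at points of $[a,b]$ presuppose that $f$ is differentiable there (one-sidedly at an endpoint of $I$). The integral of $h$ on the right-hand side is presupposed to make sense (value $+\infty$ allowed). *)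

theory Defs
  imports "HOL-Analysis.Analysis"
begin

definition super_multiplicative_on :: "real set \<Rightarrow> (real \<Rightarrow> real) \<Rightarrow> bool" where
  "super_multiplicative_on J h \<longleftrightarrow>
     (\<forall>x\<in>J. \<forall>y\<in>J. x * y \<in> J \<longrightarrow> h (x * y) \<ge> h x * h y)"

(* Only the values of h on [0,1] matter here; that h is nonnegative and not identically zero
   on a domain J containing [0,1] is to be assumed separately wherever this notion is used. *)
definition h_convex_on :: "(real \<Rightarrow> real) \<Rightarrow> real set \<Rightarrow> (real \<Rightarrow> real) \<Rightarrow> bool" where
  "h_convex_on h K g \<longleftrightarrow>
     (\<forall>x\<in>K. 0 \<le> g x) \<and>
     (\<forall>x\<in>K. \<forall>y\<in>K. \<forall>t\<in>{0..1}.
        g (t * x + (1 - t) * y) \<le> h t * g x + h (1 - t) * g y)"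

(* Real powers on [0,\<infinity>], meant for exponents p > 0, so that \<infinity> is sent to \<infinity>. *)
definition ennreal_powr :: "ennreal \<Rightarrow> real \<Rightarrow> ennreal" where
  "ennreal_powr z p = (if z = \<infinity> then \<infinity> else ennreal (enn2real z powr p))"

end

theory Submission
  imports Defs
begin

text \<open>Since \<open>h \<alpha> \<ge> \<alpha>\<close>, the integrand \<open>h (t\<^sup>2) + h (t - t\<^sup>2)\<close> dominates \<open>t\<^sup>2 + (t - t\<^sup>2) = t\<close>, so
  its integral is at least \<open>1 / 2\<close> and the factors involving \<open>q\<close> have product at least \<open>1\<close>. The
  claim therefore follows from the classical Ostrowski inequality, which only uses that \<open>f\<close> is
  \<open>M\<close>-Lipschitz on \<open>[a, b]\<close>.\<close>

text \<open>Split at \<open>x\<close>, where \<open>x - u\<close> changes sign: each half has a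
  quadratic antiderivative. The two halves yield the two squares in the final bound.\<close>

lemma has_integral_abs_diff:
  fixes a b x :: real
  assumes "x \<in> {a..b}"
  shows "((\<lambda>u. \<bar>x - u\<bar>) has_integral ((x - a)\<^sup>2 + (b - x)\<^sup>2) / 2) {a..b}"
proof -
  \<comment> \<open>The vanishing term \<open>(x - x)\<^sup>2 / 2\<close> is left unsimplified, so
    that the value has the shape \<open>F x - F a\<close> with
    \<open>F u = - ((x - u)\<^sup>2 / 2)\<close>.\<close>
  have "((\<lambda>u. x - u) has_integral (- ((x - x)\<^sup>2 / 2) - - ((x - a)\<^sup>2 / 2))) {a..x}"
    using assms
    by (intro fundamental_theorem_of_calculus)
       (auto intro!: derivative_eq_intros simp: field_simps
             simp flip: has_real_derivative_iff_has_vector_derivative)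
  then have left: "((\<lambda>u. \<bar>x - u\<bar>) has_integral (x - a)\<^sup>2 / 2) {a..x}"
    by (subst has_integral_cong[where g = "\<lambda>u. x - u"]) auto
  have "((\<lambda>u. u - x) has_integral ((b - x)\<^sup>2 / 2 - (x - x)\<^sup>2 / 2)) {x..b}"
    using assms
    by (intro fundamental_theorem_of_calculus)
       (auto intro!: derivative_eq_intros
             simp flip: has_real_derivative_iff_has_vector_derivative)
  then have right: "((\<lambda>u. \<bar>x - u\<bar>) has_integral (b - x)\<^sup>2 / 2) {x..b}"
    by (subst has_integral_cong[where g = "\<lambda>u. u - x"]) auto
  from has_integral_combine[OF _ _ left right] assms show ?thesis
    by (simp add: add_divide_distrib)
qed

text \<open>The deviation of \<open>f x\<close> from the mean of \<open>f\<close> is the mean of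
  \<open>f x - f u\<close> over \<open>u\<close>. Bounding this by
  \<open>M * \<bar>x - u\<bar>\<close> under the integral leaves the integral computed
  above.\<close>

lemma ostrowski_lipschitz:
  fixes f :: "real \<Rightarrow> real" and a b x M :: real
  assumes "a < b" and x: "x \<in> {a..b}"
    and cont: "continuous_on {a..b} f"
    and lip: "\<And>u. u \<in> {a..b} \<Longrightarrow> \<bar>f x - f u\<bar> \<le> M * \<bar>x - u\<bar>"
  shows "\<bar>f x - 1 / (b - a) * integral {a..b} f\<bar>
           \<le> M / (2 * (b - a)) * ((x - a)\<^sup>2 + (b - x)\<^sup>2)"
proof -
  have f: "f integrable_on {a..b}"
    using cont by (rule integrable_continuous_interval)
  have rhs: "((\<lambda>u. M * \<bar>x - u\<bar>) has_integral M * (((x - a)\<^sup>2 + (b - x)\<^sup>2) / 2)) {a..b}"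
    by (intro has_integral_mult_right has_integral_abs_diff x)
  have "(b - a) * f x - integral {a..b} f = integral {a..b} (\<lambda>u. f x - f u)"
    using f \<open>a < b\<close> by (subst Henstock_Kurzweil_Integration.integral_diff) auto
  also have "\<bar>\<dots>\<bar> \<le> integral {a..b} (\<lambda>u. M * \<bar>x - u\<bar>)"
    unfolding real_norm_def[symmetric]
    using f rhs lip
    by (intro integral_norm_bound_integral)
       (auto simp: has_integral_integrable
             intro: Henstock_Kurzweil_Integration.integrable_diff)
  also have "\<dots> = M * (((x - a)\<^sup>2 + (b - x)\<^sup>2) / 2)"
    using rhs by (rule integral_unique)
  finally have *: "\<bar>(b - a) * f x - integral {a..b} f\<bar> \<le> M * (((x - a)\<^sup>2 + (b - x)\<^sup>2) / 2)" .
  have "f x - 1 / (b - a) * integral {a..b} f = ((b - a) * f x - integral {a..b} f) / (b - a)"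
    using \<open>a < b\<close> by (simp add: field_simps)
  then have "\<bar>f x - 1 / (b - a) * integral {a..b} f\<bar>
      = \<bar>(b - a) * f x - integral {a..b} f\<bar> / (b - a)"
    using \<open>a < b\<close> by simp
  also have "\<dots> \<le> M * (((x - a)\<^sup>2 + (b - x)\<^sup>2) / 2) / (b - a)"
    using * \<open>a < b\<close> by (intro divide_right_mono) auto
  finally show ?thesis
    by simp
qed

lemma nn_integral_ge_half:
  fixes g :: "real \<Rightarrow> real"
  assumes "\<And>t. t \<in> {0<..<1} \<Longrightarrow> t \<le> g t"
  shows "ennreal (1 / 2) \<le> (\<integral>\<^sup>+t\<in>{0..1}. ennreal (g t) \<partial>lebesgue)"
proof -
  have "((\<lambda>t::real. t) has_integral (1\<^sup>2 / 2 - 0\<^sup>2 / 2)) {0..1}"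
    by (intro fundamental_theorem_of_calculus)
       (auto intro!: derivative_eq_intros
             simp flip: has_real_derivative_iff_has_vector_derivative)
  \<comment> \<open>The endpoints form a null set; they are dropped because \<open>g\<close> is
    bounded below only on the open interval.\<close>
  then have "((\<lambda>t::real. t) has_integral (1 / 2)) {0<..<1}"
    using has_integral_open_interval[of "\<lambda>t::real. t" "1 / 2" 0 1] by simp
  \<comment> \<open>\<open>lebesgue\<close> is the completion of \<open>lborel\<close>, and
    completing a measure does not change \<open>nn_integral\<close>.\<close>
  then have "(\<integral>\<^sup>+t. ennreal (indicator {0<..<1} t * t) \<partial>lebesgue) = ennreal (1 / 2)"
    unfolding nn_integral_completion by (intro nn_integral_has_integral_lebesgue) auto
  then have "ennreal (1 / 2) = (\<integral>\<^sup>+t. ennreal (indicator {0<..<1} t * t) \<partial>lebesgue)"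
    by simp
  also have "\<dots> \<le> (\<integral>\<^sup>+t\<in>{0..1}. ennreal (g t) \<partial>lebesgue)"
    using assms by (intro nn_integral_mono) (auto split: split_indicator intro!: ennreal_leI)
  finally show ?thesis .
qed

text \<open>For finite \<open>z\<close> this is monotonicity of \<open>powr\<close> in its base; for
  infinite \<open>z\<close> it rests on the convention that \<open>ennreal_powr\<close> sends
  \<infinity> to \<infinity>.\<close>

lemma ennreal_powr_mono_ennreal:
  assumes "0 \<le> c" "0 \<le> p" "ennreal c \<le> z"
  shows "ennreal (c powr p) \<le> ennreal_powr z p"
proof (cases z)
  case (real r)
  with assms show ?thesis
    by (auto simp: ennreal_powr_def intro!: ennreal_leI powr_mono2)
next
  case top
  then show ?thesis
    by (simp add: ennreal_powr_def)
qed

theorem theorem4: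
  fixes I J :: "real set" and h f f' :: "real \<Rightarrow> real" and a b q M x :: real
  assumes I: "is_interval I"
    and J: "is_interval J" "{0..1} \<subseteq> J"
    and h_nonneg: "\<And>t. t \<in> J \<Longrightarrow> 0 \<le> h t"
    and h_nonzero: "\<exists>t\<in>J. h t \<noteq> 0"
    and h_super: "super_multiplicative_on J h"
    and h_ge: "\<And>\<alpha>. \<alpha> \<in> {0<..<1} \<Longrightarrow> \<alpha> \<le> h \<alpha>"
    and h_meas: "set_borel_measurable lebesgue {0..1} (\<lambda>t. h (t\<^sup>2) + h (t - t\<^sup>2))"
    and ab: "a \<in> I" "b \<in> I" "a < b"
    and f_deriv: "\<And>u. u \<in> interior I \<Longrightarrow> (f has_real_derivative f' u) (at u)"
    and f_deriv_ab: "\<And>u. u \<in> {a..b} \<Longrightarrow> (f has_real_derivative f' u) (at u within I)"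
    and f'_int: "set_integrable lebesgue {a..b} f'"
    and q: "1 \<le> q"
    and f'_conv: "h_convex_on h {a..b} (\<lambda>u. \<bar>f' u\<bar> powr q)"
    and f'_bound: "\<And>u. u \<in> {a..b} \<Longrightarrow> \<bar>f' u\<bar> \<le> M"
    and x: "x \<in> {a..b}"
  shows "ennreal \<bar>f x - 1 / (b - a) * (LINT u:{a..b}|lebesgue. f u)\<bar>
    \<le> ennreal (2 powr (1 / q) * M / (2 * (b - a)) * ((x - a)\<^sup>2 + (b - x)\<^sup>2))
        * ennreal_powr (\<integral>\<^sup>+t\<in>{0..1}. ennreal (h (t\<^sup>2) + h (t - t\<^sup>2)) \<partial>lebesgue) (1 / q)"
proof -
  have sub: "{a..b} \<subseteq> I"
    using mem_is_interval_1_I[OF I ab(1,2)] by auto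
  have deriv: "(f has_real_derivative f' u) (at u within {a..b})" if "u \<in> {a..b}" for u
    using f_deriv_ab[OF that] sub by (rule has_field_derivative_subset)
  then have cont: "continuous_on {a..b} f"
    by (rule DERIV_continuous_on)
  \<comment> \<open>Mean value inequality on the convex set \<open>{a..b}\<close>; derivatives
    within the interval suffice, so one-sided ones at \<open>a\<close> and \<open>b\<close> are
    covered.\<close>
  have lip: "\<bar>f x - f u\<bar> \<le> M * \<bar>x - u\<bar>" if "u \<in> {a..b}" for u
    using field_differentiable_bound[of "{a..b}" f f' M x u] deriv f'_bound x that by auto
  have M: "0 \<le> M"
    using f'_bound[OF x] by linarith
  define S where "S = (x - a)\<^sup>2 + (b - x)\<^sup>2"
  define N where "N = (\<integral>\<^sup>+t\<in>{0..1}. ennreal (h (t\<^sup>2) + h (t - t\<^sup>2)) \<partial>lebesgue)"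
  define A where "A = M / (2 * (b - a)) * S"
  \<comment> \<open>The sign matters because \<open>ennreal\<close> truncates negative reals to 0;
    it lets \<open>ennreal\<close> be distributed over a product below.\<close>
  have "0 \<le> A"
    using M ab by (simp add: A_def S_def)
  have "t \<le> h (t\<^sup>2) + h (t - t\<^sup>2)" if t: "t \<in> {0<..<1}" for t
  proof -
    \<comment> \<open>Strictness puts both arguments of \<open>h\<close> in the open unit interval,
      where \<open>h_ge\<close> applies.\<close>
    from t have "0 < t\<^sup>2" "t\<^sup>2 < t"
      by (auto simp: power2_eq_square)
    moreover from t have "t < 1"
      by simp
    ultimately have "t\<^sup>2 \<in> {0<..<1}" "t - t\<^sup>2 \<in> {0<..<1}"
      unfolding greaterThanLessThan_iff by linarith+
    then show ?thesis
      using h_ge[of "t\<^sup>2"] h_ge[of "t - t\<^sup>2"] by linarith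
  qed
  then have "ennreal (1 / 2) \<le> N"
    unfolding N_def by (rule nn_integral_ge_half)
  then have N: "ennreal ((1 / 2) powr (1 / q)) \<le> ennreal_powr N (1 / q)"
    using q by (intro ennreal_powr_mono_ennreal) auto
  have "set_integrable lebesgue {a..b} f"
    using cont by (intro absolutely_integrable_continuous_real)
  then have "(LINT u:{a..b}|lebesgue. f u) = integral {a..b} f"
    by (rule set_lebesgue_integral_eq_integral(2))
  then have "\<bar>f x - 1 / (b - a) * (LINT u:{a..b}|lebesgue. f u)\<bar> \<le> A"
    using ostrowski_lipschitz[OF \<open>a < b\<close> x cont lip] by (simp add: A_def S_def)
  then have "ennreal \<bar>f x - 1 / (b - a) * (LINT u:{a..b}|lebesgue. f u)\<bar> \<le> ennreal A"
    by (rule ennreal_leI)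
  \<comment> \<open>Insert 1 as the product of the powers of 2 and 1/2 with exponent
    \<open>1 / q\<close>; the second power is then replaced by the larger
    \<open>ennreal_powr N (1 / q)\<close>.\<close>
  also have "A = 2 powr (1 / q) * A * (1 / 2) powr (1 / q)"
    by (simp add: powr_divide)
  also have "ennreal \<dots> = ennreal (2 powr (1 / q) * A) * ennreal ((1 / 2) powr (1 / q))"
    using \<open>0 \<le> A\<close> by (intro ennreal_mult) auto
  also have "\<dots> \<le> ennreal (2 powr (1 / q) * A) * ennreal_powr N (1 / q)"
    using N by (rule mult_left_mono) simp
  finally show ?thesis
    by (simp add: A_def S_def N_def mult.assoc)
qed

end
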